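(* Let $n\ge2$ be even, $r\in[0,n/2]$ and $s=n/2-r$. Let $S\subseteq\mathbb{Z}_4^n$ be the set of vectors of type $(r,s,r,s)$ and let $G(r,s)$ be the Cayley graph on $\mathbb{Z}_4^n$ with connection set $S$ (vertices $\mathbf{u},\mathbf{w}$ adjacent iff $\mathbf{u}-\mathbf{w}\in S$). For $\mathbf{v}\in\mathbb{Z}_4^n$ of type $(t_0,t_1,t_2,t_3)$, the eigenvalue $\lambda(\mathbf{v})=\sum_{\mathbf{b}\in S}\zeta_4^{\mathbf{b}\cdot\mathbf{v}}$ of $G(r,s)$ (with $\zeta_4=\sqrt{-1}$) equals $$\lambda(\mathbf{v})=\frac{\binom{n}{r,s,r,s}}{\binom{n}{t_0,t_1,t_2,t_3}}\Big(\big((x+z)^2-(y+w)^2\big)^r\big((x-z)^2+(y-w)^2\big)^s\Big)[t_0,t_1,t_2,t_3].$$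
   Context: For $\mathbf{v}\in\mathbb{Z}_4^n$, its type is $(t_0,t_1,t_2,t_3)$ where $t_k$ is the number of coordinates equal to $k$. $\mathbf{b}\cdot\mathbf{v}=\sum_k b_kv_k\in\mathbb{Z}_4$. The numbers $\lambda(\mathbf{v})$, $\mathbf{v}\in\mathbb{Z}_4^n$, are exactly the eigenvalues of $G(r,s)$, with eigenvectors $(\zeta_4^{\mathbf{v}\cdot\mathbf{b}})_{\mathbf{b}\in\mathbb{Z}_4^n}$. Multinomial coefficients: $\binom{n}{a,b,c,d}=\frac{n!}{a!b!c!d!}$. For a polynomial $f(x,y,z,w)$, $f[t_0,t_1,t_2,t_3]$ is the coefficient of $x^{t_0}y^{t_1}z^{t_2}w^{t_3}$. *)

theory Defs
  imports "HOL-Analysis.Analysis" "HOL-Library.Poly_Mapping"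
begin

text \<open>
  The ring \<open>\<int>\<^sub>4\<close> is the numeral type \<open>4\<close>, and \<open>\<int>\<^sub>4\<^sup>n\<close> is \<open>4 ^ 'n\<close> with \<open>n = CARD('n)\<close>.
  The dot product of two such vectors is the library's \<open>scalar_product\<close>.
\<close>

definition coord_count :: "4 ^ 'n \<Rightarrow> 4 \<Rightarrow> nat"
  where "coord_count v k = card {i. v $ i = k}"

definition vec_type :: "4 ^ 'n \<Rightarrow> nat \<times> nat \<times> nat \<times> nat"
  where "vec_type v = (coord_count v 0, coord_count v 1, coord_count v 2, coord_count v 3)"

definition vecs_of_type :: "nat \<times> nat \<times> nat \<times> nat \<Rightarrow> (4 ^ 'n) set"
  where "vecs_of_type t = {b. vec_type b = t}"

text \<open>
  \<open>zeta4_pow k\<close> is \<open>\<zeta>\<^sub>4\<^sup>k\<close> for \<open>k \<in> \<int>\<^sub>4\<close>; \<open>Rep_bit0 k\<close> is the representative of \<open>k\<close> in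
  \<open>{0, 1, 2, 3}\<close>.
\<close>

definition zeta4_pow :: "4 \<Rightarrow> complex"
  where "zeta4_pow k = \<i> ^ nat (Rep_bit0 k)"

definition cayley_graph :: "'g::group_add set \<Rightarrow> 'g \<Rightarrow> 'g \<Rightarrow> bool"
  where "cayley_graph S u w \<longleftrightarrow> u - w \<in> S"

definition adjacency_matrix :: "('a::finite \<Rightarrow> 'a \<Rightarrow> bool) \<Rightarrow> complex ^ 'a ^ 'a"
  where "adjacency_matrix E = (\<chi> u w. if E u w then 1 else 0)"

definition graph_eigenpair :: "('a::finite \<Rightarrow> 'a \<Rightarrow> bool) \<Rightarrow> complex \<Rightarrow> complex ^ 'a \<Rightarrow> bool"
  where "graph_eigenpair E \<mu> x \<longleftrightarrow> x \<noteq> 0 \<and> adjacency_matrix E *v x = \<mu> *s x"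

definition G_conn :: "nat \<Rightarrow> nat \<Rightarrow> (4 ^ 'n) set"
  where "G_conn r s = vecs_of_type (r, s, r, s)"

definition G_graph :: "nat \<Rightarrow> nat \<Rightarrow> 4 ^ 'n \<Rightarrow> 4 ^ 'n \<Rightarrow> bool"
  where "G_graph r s = cayley_graph (G_conn r s)"

definition G_lambda :: "nat \<Rightarrow> nat \<Rightarrow> 4 ^ 'n \<Rightarrow> complex"
  where "G_lambda r s v = (\<Sum>b\<in>G_conn r s. zeta4_pow (scalar_product b v))"

definition char_vec :: "4 ^ 'n \<Rightarrow> complex ^ (4 ^ 'n)"
  where "char_vec v = (\<chi> b. zeta4_pow (scalar_product v b))"

definition multinomial4 :: "nat \<Rightarrow> nat \<Rightarrow> nat \<Rightarrow> nat \<Rightarrow> nat \<Rightarrow> real"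
  where "multinomial4 n a b c d = fact n / (fact a * fact b * fact c * fact d)"

text \<open>
  Polynomials in the four variables \<open>x, y, z, w\<close>, which are indexed by \<open>0, 1, 2, 3\<close> in this
  order; monomials are the exponent maps \<open>4 \<Rightarrow>\<^sub>0 nat\<close>.
\<close>

type_synonym 'a poly4 = "(4 \<Rightarrow>\<^sub>0 nat) \<Rightarrow>\<^sub>0 'a"

definition var4 :: "4 \<Rightarrow> int poly4"
  where "var4 k = Poly_Mapping.single (Poly_Mapping.single k 1) 1"

definition coeff4 :: "'a::zero poly4 \<Rightarrow> nat \<Rightarrow> nat \<Rightarrow> nat \<Rightarrow> nat \<Rightarrow> 'a"
  where "coeff4 f a b c d =
    Poly_Mapping.lookup f (Poly_Mapping.single 0 a + Poly_Mapping.single 1 b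
      + Poly_Mapping.single 2 c + Poly_Mapping.single 3 d)"

definition G_poly :: "nat \<Rightarrow> nat \<Rightarrow> int poly4"
  where "G_poly r s =
    (let x = var4 0; y = var4 1; z = var4 2; w = var4 3
     in ((x + z)\<^sup>2 - (y + w)\<^sup>2) ^ r * ((x - z)\<^sup>2 + (y - w)\<^sup>2) ^ s)"

end

theory Submission
  imports Defs "HOL-Combinatorics.Multiset_Permutations"
begin

text \<open>
  Expanding \<open>\<Prod>\<^sub>i (x + \<zeta>\<^sub>4\<^bsup>v\<^sub>i\<^esup> y + \<zeta>\<^sub>4\<^bsup>2v\<^sub>i\<^esup> z + \<zeta>\<^sub>4\<^bsup>3v\<^sub>i\<^esup> w)\<close> shows that the sum of
  \<open>\<zeta>\<^sub>4\<^bsup>b\<cdot>v\<^esup>\<close> over all \<open>b\<close> of a given type is a coefficient of a polynomial that depends only on the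
  type of \<open>v\<close>. In particular \<open>\<lambda>(v)\<close> is constant on the set \<open>T\<close> of vectors of type
  \<open>(t\<^sub>0, t\<^sub>1, t\<^sub>2, t\<^sub>3)\<close>, and for \<open>v\<close> of type \<open>(r, s, r, s)\<close> the polynomial is the one in the theorem.
  Summing \<open>\<zeta>\<^sub>4\<^bsup>b\<cdot>v\<^esup>\<close> over \<open>S \<times> T\<close> in both orders gives \<open>|T| \<lambda>(v) = |S| \<cdot> coefficient\<close>, and the two
  cardinalities are multinomial coefficients. The characters are eigenvectors because \<open>S = -S\<close>.
\<close>

section \<open>Counting functions with prescribed fibre sizes\<close>

text \<open>Along a fixed enumeration \<open>xs\<close> of the domain, a function becomes a word,
  and prescribed fibre sizes say that this word permutes a fixed multiset.\<close>

lemma card_functions_with_fibre_sizes: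
  fixes c :: "'b::finite \<Rightarrow> nat"
  assumes "(\<Sum>k\<in>UNIV. c k) = CARD('a::finite)"
  shows "card {f :: 'a \<Rightarrow> 'b. \<forall>k. card {i. f i = k} = c k} * (\<Prod>k\<in>UNIV. fact (c k))
    = fact CARD('a)"
proof -
  obtain xs :: "'a list" where xs: "set xs = UNIV" "distinct xs"
    using finite_distinct_list[of "UNIV :: 'a set"] by auto
  define A where "A = (\<Sum>k\<in>UNIV. replicate_mset (c k) k)"
  have count_A: "count A k = c k" for k
    by (simp add: A_def count_sum)
  have size_A: "size A = CARD('a)"
    using assms by (simp add: A_def size_multiset_sum)
  have count_map: "count (mset (map f xs)) k = card {i. f i = k}" for f :: "'a \<Rightarrow> 'b" and k
  proof -
    have "count (mset (map f xs)) k = length (filter (\<lambda>i. f i = k) xs)"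
      by (induction xs) auto
    also have "\<dots> = card {i. f i = k}"
      using xs by (simp flip: distinct_card)
    finally show ?thesis .
  qed
  have "bij_betw (\<lambda>f. map f xs) {f. \<forall>k. card {i. f i = k} = c k} (permutations_of_multiset A)"
  proof (rule bij_betw_imageI)
    show "inj_on (\<lambda>f. map f xs) {f. \<forall>k. card {i. f i = k} = c k}"
      using xs by (auto intro!: inj_onI simp: fun_eq_iff)
    show "(\<lambda>f. map f xs) ` {f. \<forall>k. card {i. f i = k} = c k} = permutations_of_multiset A"
    proof (intro equalityI subsetI)
      fix ys assume "ys \<in> (\<lambda>f. map f xs) ` {f. \<forall>k. card {i. f i = k} = c k}"
      then show "ys \<in> permutations_of_multiset A"
        using count_map by (auto simp: permutations_of_multiset_def multiset_eq_iff count_A)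
    next
      fix ys assume ys: "ys \<in> permutations_of_multiset A"
      then have len: "length ys = length xs"
        using xs size_A distinct_card[OF xs(2)]
        by (metis permutations_of_multisetD size_mset)
      define f where "f = the \<circ> map_of (zip xs ys)"
      have "map f xs = ys"
        using len xs by (intro nth_equalityI) (auto simp: f_def map_of_zip_nth)
      moreover from this have "\<forall>k. card {i. f i = k} = c k"
        using permutations_of_multisetD[OF ys] count_map[of f] count_A by simp
      ultimately show "ys \<in> (\<lambda>f. map f xs) ` {f. \<forall>k. card {i. f i = k} = c k}"
        by blast
    qed
  qed
  then have "card {f :: 'a \<Rightarrow> 'b. \<forall>k. card {i. f i = k} = c k} = card (permutations_of_multiset A)"
    by (rule bij_betw_same_card)
  \<comment> \<open>Values with \<open>c k = 0\<close> are absent from \<open>A\<close> and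
    contribute the factor \<open>fact 0 = 1\<close>.\<close>
  moreover have "(\<Prod>k\<in>set_mset A. fact (count A k)) = (\<Prod>k\<in>UNIV. fact (c k) :: nat)"
    by (rule prod.mono_neutral_cong_left) (auto simp: count_A not_in_iff)
  ultimately show ?thesis
    using card_permutations_of_multiset_aux[of A] by (simp add: size_A)
qed

section \<open>Vectors over the integers modulo 4\<close>

text \<open>\<open>UNIV_4\<close> and \<open>forall_4\<close> list the elements as 1, 2, 3, 4; this
  puts 0 in place of 4.\<close>

lemma four_eq_zero: "(4 :: 4) = 0"
  by simp

lemma UNIV_4_from_0: "(UNIV :: 4 set) = {0, 1, 2, 3}"
  unfolding UNIV_4 four_eq_zero by blast

lemma prod_4: "(\<Prod>k\<in>UNIV. f k) = f 0 * f 1 * f 2 * f (3 :: 4)"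
  unfolding UNIV_4_from_0 by (simp add: mult.assoc)

lemma sum_4_from_0: "(\<Sum>k\<in>UNIV. f k) = f 0 + f 1 + f 2 + f (3 :: 4)"
  unfolding UNIV_4_from_0 by (simp add: add.assoc)

lemma all_4: "(\<forall>k. P k) \<longleftrightarrow> P 0 \<and> P 1 \<and> P 2 \<and> P (3 :: 4)"
  unfolding forall_4 four_eq_zero by blast

definition monom4 :: "nat \<times> nat \<times> nat \<times> nat \<Rightarrow> 4 \<Rightarrow>\<^sub>0 nat"
  where "monom4 = (\<lambda>(a, b, c, d). Poly_Mapping.single 0 a + Poly_Mapping.single 1 b
      + Poly_Mapping.single 2 c + Poly_Mapping.single 3 d)"

lemma lookup_monom4:
  "Poly_Mapping.lookup (monom4 (a, b, c, d)) 0 = a"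
  "Poly_Mapping.lookup (monom4 (a, b, c, d)) 1 = b"
  "Poly_Mapping.lookup (monom4 (a, b, c, d)) 2 = c"
  "Poly_Mapping.lookup (monom4 (a, b, c, d)) 3 = d"
  by (simp_all add: monom4_def lookup_add lookup_single)

lemma vec_type_eq_iff: "vec_type v = t \<longleftrightarrow> (\<forall>k. coord_count v k = Poly_Mapping.lookup (monom4 t) k)"
  by (cases t) (simp add: all_4 lookup_monom4 vec_type_def)

text \<open>Coordinate \<open>i\<close> contributes one factor of the variable with index
  \<open>b $ i\<close>, so the exponents of the product are the coordinate counts.\<close>

lemma sum_single_eq_monom4_iff:
  fixes b :: "4 ^ 'n"
  shows "(\<Sum>i\<in>UNIV. Poly_Mapping.single (b $ i) 1) = monom4 t \<longleftrightarrow> vec_type b = t"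
proof -
  have "Poly_Mapping.lookup (\<Sum>i\<in>UNIV. Poly_Mapping.single (b $ i) 1) k = coord_count b k" for k
    by (simp add: lookup_sum lookup_single when_def coord_count_def flip: sum.inter_filter)
  then show ?thesis
    by (simp add: vec_type_eq_iff poly_mapping_eq_iff fun_eq_iff)
qed

lemma sum_coord_count: "(\<Sum>k\<in>UNIV. coord_count (v :: 4 ^ 'n) k) = CARD('n)"
proof -
  have "(\<Sum>k\<in>UNIV. \<Sum>i\<in>{i \<in> UNIV. v $ i = k}. 1) = (\<Sum>i\<in>(UNIV :: 'n set). 1 :: nat)"
    by (rule sum.group) auto
  then show ?thesis by (simp add: coord_count_def)
qed

lemma prod_component_eq_prod_power_coord_count:
  fixes F :: "4 \<Rightarrow> 'a::comm_monoid_mult" and v :: "4 ^ 'n"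
  shows "(\<Prod>i\<in>UNIV. F (v $ i)) = (\<Prod>k\<in>UNIV. F k ^ coord_count v k)"
proof -
  have "(\<Prod>i\<in>UNIV. F (v $ i)) = (\<Prod>k\<in>UNIV. \<Prod>i\<in>{i\<in>UNIV. v $ i = k}. F (v $ i))"
    by (rule prod.group[symmetric]) auto
  also have "\<dots> = (\<Prod>k\<in>UNIV. F k ^ coord_count v k)"
    by (rule prod.cong) (simp_all add: coord_count_def)
  finally show ?thesis .
qed

lemma card_vecs_of_type:
  assumes "a + b + c + d = CARD('n)"
  shows "real (card (vecs_of_type (a, b, c, d) :: (4 ^ 'n) set)) = multinomial4 CARD('n) a b c d"
proof -
  let ?c = "Poly_Mapping.lookup (monom4 (a, b, c, d))"
  let ?A = "{f :: 'n \<Rightarrow> 4. \<forall>k. card {i. f i = k} = ?c k}"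
  have "bij_betw vec_lambda ?A (vecs_of_type (a, b, c, d))"
    by (rule bij_betwI[where g = vec_nth])
      (auto simp: vecs_of_type_def vec_type_eq_iff coord_count_def)
  then have "card (vecs_of_type (a, b, c, d) :: (4 ^ 'n) set) = card ?A"
    by (rule bij_betw_same_card[symmetric])
  moreover have "card ?A * (\<Prod>k\<in>UNIV. fact (?c k)) = fact CARD('n)"
    by (rule card_functions_with_fibre_sizes) (simp add: sum_4_from_0 lookup_monom4 assms)
  ultimately have "card (vecs_of_type (a, b, c, d) :: (4 ^ 'n) set)
      * (fact a * fact b * fact c * fact d) = fact CARD('n)"
    by (simp add: prod_4 lookup_monom4)
  then have "real (card (vecs_of_type (a, b, c, d) :: (4 ^ 'n) set)
      * (fact a * fact b * fact c * fact d)) = real (fact CARD('n))"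
    by (simp only:)
  then have "real (card (vecs_of_type (a, b, c, d) :: (4 ^ 'n) set))
      * (fact a * fact b * fact c * fact d) = fact CARD('n)"
    by (simp only: of_nat_mult of_nat_fact)
  then show ?thesis
    by (simp add: multinomial4_def field_simps)
qed

section \<open>Characters\<close>

text \<open>
  The simplifier does not reduce numerals modulo 4, so sums and products of elements of
  \<open>{0, 1, 2, 3}\<close> leave the larger arguments below.
\<close>
lemma zeta4_pow_values [simp]:
  "zeta4_pow 0 = 1" "zeta4_pow 1 = \<i>" "zeta4_pow 2 = -1" "zeta4_pow 3 = -\<i>"
  "zeta4_pow 4 = 1" "zeta4_pow 5 = \<i>" "zeta4_pow 6 = -1" "zeta4_pow 9 = \<i>"
  by (simp_all add: zeta4_pow_def bit0.Rep_0 bit0.Rep_1 bit0.Rep_numeral eval_nat_numeral)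

lemma zeta4_pow_add: "zeta4_pow (a + b) = zeta4_pow a * zeta4_pow b"
proof -
  have "\<forall>a b. zeta4_pow (a + b) = zeta4_pow a * zeta4_pow b"
    unfolding all_4 by simp
  then show ?thesis by blast
qed

lemma zeta4_pow_nonzero: "zeta4_pow a \<noteq> 0"
  by (simp add: zeta4_pow_def)

lemma zeta4_pow_sum: "finite A \<Longrightarrow> zeta4_pow (\<Sum>i\<in>A. f i) = (\<Prod>i\<in>A. zeta4_pow (f i))"
  by (induction A rule: finite_induct) (simp_all add: zeta4_pow_add)

lemma scalar_product_commute: "scalar_product v w = scalar_product w (v :: 'a::comm_semiring_1 ^ 'n)"
  by (simp add: scalar_product_def mult.commute)

lemma scalar_product_add_right:
  "scalar_product v (u + w) = scalar_product v u + scalar_product (v :: 'a::semiring_1 ^ 'n) w"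
  by (simp add: scalar_product_def distrib_left sum.distrib)

lemma coord_count_uminus: "coord_count (- b) k = coord_count b (- k)"
  unfolding coord_count_def by (rule arg_cong[where f = card]) auto

text \<open>Negation modulo 4 fixes 0 and 2 and swaps 1 and 3, whose multiplicities are both
  \<open>s\<close>.\<close>

lemma uminus_in_G_conn_iff: "- b \<in> G_conn r s \<longleftrightarrow> b \<in> G_conn r s"
proof -
  have uminus_4: "(- 1 :: 4) = 3" "(- 2 :: 4) = 2" "(- 3 :: 4) = 1"
    by simp_all
  show ?thesis
    unfolding G_conn_def vecs_of_type_def vec_type_def coord_count_uminus mem_Collect_eq minus_zero uminus_4
    by auto
qed

lemma graph_eigenpair_G_graph: "graph_eigenpair (G_graph r s) (G_lambda r s v) (char_vec v)"
proof -
  have "(adjacency_matrix (G_graph r s) *v char_vec v) $ u = (G_lambda r s v *s char_vec v) $ u"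
    for u
  proof -
    have "(adjacency_matrix (G_graph r s) *v char_vec v) $ u
        = (\<Sum>w\<in>UNIV. if u - w \<in> G_conn r s then zeta4_pow (scalar_product v w) else 0)"
      by (auto simp: matrix_vector_mult_def adjacency_matrix_def G_graph_def cayley_graph_def
          char_vec_def intro!: sum.cong)
    also have "\<dots> = (\<Sum>w | u - w \<in> G_conn r s. zeta4_pow (scalar_product v w))"
      by (simp add: sum.If_cases)
    \<comment> \<open>With \<open>w = u + b\<close>, adjacency reads
      \<open>- b \<in> G_conn r s\<close>, so the symmetry of the connection set applies.\<close>
    also have "\<dots> = (\<Sum>b\<in>G_conn r s. zeta4_pow (scalar_product v (u + b)))"
      by (rule sum.reindex_bij_witness[where i = "\<lambda>b. u + b" and j = "\<lambda>w. w - u"])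
        (auto simp: uminus_in_G_conn_iff dest: uminus_in_G_conn_iff[THEN iffD2])
    also have "\<dots> = (G_lambda r s v *s char_vec v) $ u"
      by (simp add: scalar_product_add_right zeta4_pow_add G_lambda_def char_vec_def
          sum_distrib_left mult.commute scalar_product_commute[of v])
    finally show ?thesis .
  qed
  moreover have "char_vec v \<noteq> 0"
    by (simp add: char_vec_def vec_eq_iff zeta4_pow_nonzero)
  ultimately show ?thesis
    by (simp add: graph_eigenpair_def vec_eq_iff)
qed

section \<open>The generating polynomial of character sums\<close>

text \<open>The linear factor contributed by a coordinate of value \<open>k\<close> to the
  generating product.\<close>

definition char_form :: "4 \<Rightarrow> complex poly4"
  where "char_form k = (\<Sum>j\<in>UNIV. Poly_Mapping.single (Poly_Mapping.single j 1) (zeta4_pow (j * k)))"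

lemma prod_single:
  "finite A \<Longrightarrow> (\<Prod>i\<in>A. Poly_Mapping.single (m i) (c i))
    = Poly_Mapping.single (\<Sum>i\<in>A. m i) (\<Prod>i\<in>A. c i :: 'a::comm_semiring_1)"
  by (induction A rule: finite_induct) (simp_all add: mult_single)

lemma sum_vecs_of_type_zeta4_pow:
  fixes v :: "4 ^ 'n"
  shows "(\<Sum>b\<in>vecs_of_type t. zeta4_pow (scalar_product b v))
    = Poly_Mapping.lookup (\<Prod>k\<in>UNIV. char_form k ^ coord_count v k) (monom4 t)"
proof -
  let ?S = "Poly_Mapping.single"
  have "(\<Prod>k\<in>UNIV. char_form k ^ coord_count v k) = (\<Prod>i\<in>UNIV. char_form (v $ i))"
    by (rule prod_component_eq_prod_power_coord_count[symmetric])
  \<comment> \<open>Choosing one variable from each factor amounts to choosing a vector.\<close>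
  also have "\<dots> = (\<Sum>g\<in>PiE UNIV (\<lambda>_ :: 'n. UNIV). \<Prod>i\<in>UNIV. ?S (?S (g i) 1) (zeta4_pow (g i * v $ i)))"
    unfolding char_form_def by (rule prod_sum_PiE) auto
  also have "\<dots> = (\<Sum>b\<in>UNIV. \<Prod>i\<in>UNIV. ?S (?S (b $ i) 1) (zeta4_pow (b $ i * v $ i)))"
    by (rule sum.reindex_bij_witness[where i = vec_nth and j = vec_lambda]) auto
  also have "\<dots> = (\<Sum>b\<in>UNIV. ?S (\<Sum>i\<in>UNIV. ?S (b $ i) 1) (zeta4_pow (scalar_product b v)))"
    by (simp add: prod_single scalar_product_def zeta4_pow_sum)
  finally show ?thesis
    by (simp add: lookup_sum lookup_single when_def sum_single_eq_monom4_iff vecs_of_type_def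
        del: One_nat_def flip: sum.inter_filter)
qed

section \<open>Extension of scalars\<close>

text \<open>In characteristic 0 \<open>of_int\<close> is injective, so both sums run over the same
  support.\<close>

lemma of_int_Sum_any: "of_int (Sum_any h) = (Sum_any (\<lambda>x. of_int (h x)) :: 'a::ring_char_0)"
  by (simp add: Sum_any.expand_set)

lemma of_int_when: "of_int (a when P) = (of_int a when P)"
  by (simp add: when_def)

text \<open>\<open>G_poly\<close> has integer coefficients, but its linear factors involve \<i>; the
  lemmas below transport the ring operations.\<close>

abbreviation of_int_poly4 :: "int poly4 \<Rightarrow> complex poly4"
  where "of_int_poly4 \<equiv> Poly_Mapping.map of_int"

lemma lookup_map_of_int:
  "Poly_Mapping.lookup (Poly_Mapping.map of_int f) k = of_int (Poly_Mapping.lookup f k)"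
  by (simp add: Poly_Mapping.map.rep_eq when_def)

lemma of_int_poly4_add: "of_int_poly4 (f + g) = of_int_poly4 f + of_int_poly4 g"
  by (rule poly_mapping_eqI) (simp add: lookup_map_of_int lookup_add)

lemma of_int_poly4_diff: "of_int_poly4 (f - g) = of_int_poly4 f - of_int_poly4 g"
  by (rule poly_mapping_eqI) (simp add: lookup_map_of_int lookup_minus)

lemma of_int_poly4_mult: "of_int_poly4 (f * g) = of_int_poly4 f * of_int_poly4 g"
  by (rule poly_mapping_eqI)
    (simp add: lookup_map_of_int lookup_mult of_int_Sum_any of_int_when cong: when_cong)

lemma of_int_poly4_power: "of_int_poly4 (f ^ n) = of_int_poly4 f ^ n"
proof (induction n)
  case 0
  show ?case
    by (rule poly_mapping_eqI) (simp add: lookup_map_of_int lookup_one of_int_when)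
qed (simp add: of_int_poly4_mult)

text \<open>Forms 0 and 2 are (x + z) \<plusminus> (y + w), and forms 1 and 3 are (x - z)
  \<plusminus> \<i> (y - w); each pair multiplies to a difference of squares.\<close>

lemma of_int_poly4_G_poly:
  "of_int_poly4 (G_poly r s)
    = char_form 0 ^ r * char_form 1 ^ s * char_form 2 ^ r * char_form 3 ^ s"
proof -
  define X where "X k = of_int_poly4 (var4 k)" for k
  \<comment> \<open>As a constant polynomial, \<i> becomes a ring element, and the factorizations
    reduce to algebra with \<open>I * I = -1\<close>.\<close>
  define I :: "complex poly4" where "I = Poly_Mapping.single 0 \<i>"
  have I: "I * I = -1"
    by (simp add: I_def mult_single flip: single_one single_uminus)
  have X: "X k = Poly_Mapping.single (Poly_Mapping.single k 1) 1" for k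
    by (simp add: X_def var4_def)
  have S: "Poly_Mapping.single (Poly_Mapping.single k 1) \<i> = I * X k" 
      "Poly_Mapping.single (Poly_Mapping.single k 1) (-1) = - X k" 
      "Poly_Mapping.single (Poly_Mapping.single k 1) (-\<i>) = - (I * X k)" for k
    by (simp_all add: X I_def mult_single single_uminus)
  have F: "char_form 0 = X 0 + X 1 + X 2 + X 3"
    "char_form 1 = X 0 + I * X 1 - X 2 - I * X 3"
    "char_form 2 = X 0 - X 1 + X 2 - X 3"
    "char_form 3 = X 0 - I * X 1 - X 2 + I * X 3"
    by (simp_all add: char_form_def sum_4_from_0 S del: One_nat_def single_one flip: X)
  have "char_form 0 * char_form 2 = (X 0 + X 2)\<^sup>2 - (X 1 + X 3)\<^sup>2"
    by (simp add: F power2_eq_square algebra_simps)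
  moreover have "char_form 1 * char_form 3 = (X 0 - X 2)\<^sup>2 + (X 1 - X 3)\<^sup>2"
  proof -
    have "char_form 1 * char_form 3 = (X 0 - X 2)\<^sup>2 - I * I * (X 1 - X 3)\<^sup>2"
      by (simp add: F power2_eq_square algebra_simps)
    then show ?thesis by (simp add: I)
  qed
  moreover have "of_int_poly4 (G_poly r s)
      = ((X 0 + X 2)\<^sup>2 - (X 1 + X 3)\<^sup>2) ^ r * ((X 0 - X 2)\<^sup>2 + (X 1 - X 3)\<^sup>2) ^ s"
    by (simp add: G_poly_def Let_def of_int_poly4_mult of_int_poly4_power of_int_poly4_add
        of_int_poly4_diff flip: X_def)
  ultimately have "of_int_poly4 (G_poly r s)
      = (char_form 0 * char_form 2) ^ r * (char_form 1 * char_form 3) ^ s"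
    by (simp only:)
  then show ?thesis
    by (simp only: power_mult_distrib mult_ac)
qed

section \<open>Double counting over pairs of vectors of the two types\<close>

lemma sum_vecs_of_type_zeta4_pow_G_conn:
  assumes "b \<in> G_conn r s"
  shows "(\<Sum>v\<in>vecs_of_type (t0, t1, t2, t3). zeta4_pow (scalar_product v b))
    = of_int (coeff4 (G_poly r s) t0 t1 t2 t3)"
proof -
  \<comment> \<open>The roles are exchanged: the fixed vector is now \<open>b\<close>, whose type
    supplies the exponents of the forms.\<close>
  have "coord_count b 0 = r" "coord_count b 1 = s" "coord_count b 2 = r" "coord_count b 3 = s"
    using assms by (auto simp: G_conn_def vecs_of_type_def vec_type_def)
  then show ?thesis
    unfolding sum_vecs_of_type_zeta4_pow prod_4
    by (simp add: lookup_map_of_int coeff4_def monom4_def flip: of_int_poly4_G_poly)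
qed

text \<open>The generating product depends on the vector only through its coordinate counts.\<close>

lemma G_lambda_cong:
  assumes "vec_type v = vec_type w"
  shows "G_lambda r s v = G_lambda r s w"
proof -
  have "coord_count v = coord_count w"
    using vec_type_eq_iff[of v "vec_type w"] vec_type_eq_iff[of w "vec_type w"] assms
    by (simp add: fun_eq_iff)
  then show ?thesis
    unfolding G_lambda_def G_conn_def sum_vecs_of_type_zeta4_pow by simp
qed

lemma G_lambda_mult_card:
  fixes v :: "4 ^ 'n"
  assumes "vec_type v = (t0, t1, t2, t3)"
  shows "of_nat (card (vecs_of_type (t0, t1, t2, t3) :: (4 ^ 'n) set)) * G_lambda r s v
    = of_nat (card (G_conn r s :: (4 ^ 'n) set)) * of_int (coeff4 (G_poly r s) t0 t1 t2 t3)"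
proof -
  let ?T = "vecs_of_type (t0, t1, t2, t3) :: (4 ^ 'n) set"
  have "of_nat (card ?T) * G_lambda r s v = (\<Sum>w\<in>?T. G_lambda r s v)"
    by simp
  also have "\<dots> = (\<Sum>w\<in>?T. G_lambda r s w)"
    by (intro sum.cong refl G_lambda_cong) (simp add: assms vecs_of_type_def)
  \<comment> \<open>After the interchange, every inner sum is the same coefficient of
    \<open>G_poly r s\<close>.\<close>
  also have "\<dots> = (\<Sum>b\<in>G_conn r s. \<Sum>w\<in>?T. zeta4_pow (scalar_product w b))"
    unfolding G_lambda_def by (subst sum.swap) (simp add: scalar_product_commute)
  also have "\<dots> = of_nat (card (G_conn r s :: (4 ^ 'n) set))
      * of_int (coeff4 (G_poly r s) t0 t1 t2 t3)"
    by (simp add: sum_vecs_of_type_zeta4_pow_G_conn)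
  finally show ?thesis .
qed

theorem theorem4:
  fixes r s t0 t1 t2 t3 :: nat and v :: "4 ^ 'n"
  assumes "CARD('n) \<ge> 2" and "even CARD('n)"
    and "r \<le> CARD('n) div 2" and "s = CARD('n) div 2 - r"
    and "vec_type v = (t0, t1, t2, t3)"
  shows "graph_eigenpair (G_graph r s) (G_lambda r s v) (char_vec v) \<and>
    G_lambda r s v =
      complex_of_real (multinomial4 CARD('n) r s r s / multinomial4 CARD('n) t0 t1 t2 t3
        * of_int (coeff4 (G_poly r s) t0 t1 t2 t3))"
proof
  show "graph_eigenpair (G_graph r s) (G_lambda r s v) (char_vec v)"
    by (rule graph_eigenpair_G_graph)
  \<comment> \<open>The bound on \<open>r\<close> keeps the subtraction in \<open>s\<close> from
    truncating, and evenness makes twice the half equal to the dimension.\<close>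
  have "r + s + r + s = CARD('n)"
    using assms(2-4) by auto
  then have S: "real (card (G_conn r s :: (4 ^ 'n) set)) = multinomial4 CARD('n) r s r s"
    unfolding G_conn_def by (rule card_vecs_of_type)
  have "t0 + t1 + t2 + t3 = CARD('n)"
    using sum_coord_count[of v] assms(5) by (simp add: sum_4_from_0 vec_type_def)
  then have T: "real (card (vecs_of_type (t0, t1, t2, t3) :: (4 ^ 'n) set))
      = multinomial4 CARD('n) t0 t1 t2 t3"
    by (rule card_vecs_of_type)
  have "multinomial4 CARD('n) t0 t1 t2 t3 \<noteq> 0"
    by (simp add: multinomial4_def)
  moreover have "complex_of_real (multinomial4 CARD('n) t0 t1 t2 t3) * G_lambda r s v
      = complex_of_real (multinomial4 CARD('n) r s r s) * of_int (coeff4 (G_poly r s) t0 t1 t2 t3)"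
    using G_lambda_mult_card[OF assms(5), of r s] by (simp flip: S T)
  ultimately show "G_lambda r s v =
      complex_of_real (multinomial4 CARD('n) r s r s / multinomial4 CARD('n) t0 t1 t2 t3
        * of_int (coeff4 (G_poly r s) t0 t1 t2 t3))"
    by (simp add: field_simps)
qed

end
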